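(* Suppose $\Omega=(\Omega(k))_{k\in 2\mathbb{Z}}$ is a weight of the form $\Omega(k)=\omega(k)\cdot\tilde\Omega(k)$, $k\in 2\mathbb{Z}$, where $\tilde\Omega$ is an almost submultiplicative weight and $\omega$ is a slowly increasing weight with $$\sum_{k\in 2\mathbb{Z},\,k\neq 0}\frac{1}{|k|\,\omega(k)}<\infty .$$ Let $v\in W_\infty(\Omega)$, and let $(V(k))_{k\in 2\mathbb{Z}}$ be its Fourier coefficients. (a) If $\Delta\subset\mathbb{N}$ is an infinite set such that $$|V(\pm 2n)|\,n\,\Omega(2n)\to\infty\quad\text{as } n\in\Delta,\ n\to\infty,$$ then $$\beta_n^\pm(v,z)\sim V(\pm 2n)\quad\text{for } |z|\le n/2,\ n\in\Delta,\ n\to\infty. \qquad ( * )$$ (b) If $\lim_{|k|\to\infty}|V(k)|\,\Omega(k)=0$ and $\Delta\subset\mathbb{N}$ is an infinite set such that $$\exists\, c>0:\quad |V(\pm 2n)|\,n\,\Omega(2n)\ge c\quad\text{for } n\in\Delta,$$ then $( * )$ holds.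
   Context: Weights. A weight is a sequence of positive numbers $\Omega=(\Omega(k))_{k\in 2\mathbb{Z}}$ with $\Omega(-k)=\Omega(k)$, $\Omega(0)=1$, and $\Omega(k)\le\Omega(m)$ for $m\ge k\ge 0$. A weight $\Omega$ is almost submultiplicative if there is a constant $C>0$ with $\Omega(k+m)\le C\,\Omega(k)\Omega(m)$ for all $k,m\in 2\mathbb{Z}$. A weight $\omega$ is slowly increasing if $\sup_{k\in 2\mathbb{N}}\omega(2k)/\omega(k)<\infty$. Weighted space. $W_\infty(\Omega)$ is the space of all (possibly distributional, $\pi$-periodic, complex) potentials $v(x)=\sum_{k\in 2\mathbb{Z}}V(k)e^{ikx}$ with $\|v\|_\Omega=\sup_{k\in 2\mathbb{Z}}|V(k)|\,\Omega(k)<\infty$; the $V(k)$ are the Fourier coefficients of $v$. Functionals $\beta_n^\pm$. For sufficiently large $n\in\mathbb{N}$ and $|z|<n$, $$\beta_n^-(v,z)=V(-2n)+\sum_{k=1}^\infty S_k^{12}(n,z),\qquad \beta_n^+(v,z)=V(2n)+\sum_{k=1}^\infty S_k^{21}(n,z),$$ where, all sums being over $j_1,\dots,j_k\in (n+2\mathbb{Z})\setminus\{\pm n\}$, $$S_k^{12}(n,z)=\sum_{j_1,\dots,j_k}\frac{V(-n-j_1)V(j_1-j_2)\cdots V(j_{k-1}-j_k)V(j_k-n)}{(n^2-j_1^2+z)\cdots(n^2-j_k^2+z)},$$ $$S_k^{21}(n,z)=\sum_{j_1,\dots,j_k}\frac{V(n-j_1)V(j_1-j_2)\cdots V(j_{k-1}-j_k)V(j_k+n)}{(n^2-j_1^2+z)\cdots(n^2-j_k^2+z)}.$$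 Conventions. $a_n\sim b_n$ means $a_n/b_n\to 1$; here $\beta_n^\pm(v,z)\sim V(\pm 2n)$ for $|z|\le n/2$ means $\sup_{|z|\le n/2}|\beta_n^\pm(v,z)/V(\pm 2n)-1|\to 0$ as $n\to\infty$, $n\in\Delta$. Hypotheses and conclusions with $\pm$ are asserted for both signs. *)

theory Defs
  imports "HOL-Analysis.Analysis"
begin

section \<open>Weights\<close>

text \<open>
  Sequences indexed by the even integers are functions on \<^typ>\<open>int\<close>; only their values at even
  arguments matter.
\<close>

definition weight :: "(int \<Rightarrow> real) \<Rightarrow> bool" where
  "weight \<Omega> \<longleftrightarrow>
     (\<forall>k. even k \<longrightarrow> \<Omega> k > 0 \<and> \<Omega> (- k) = \<Omega> k) \<and>
     \<Omega> 0 = 1 \<and>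
     (\<forall>k m. even k \<longrightarrow> even m \<longrightarrow> 0 \<le> k \<longrightarrow> k \<le> m \<longrightarrow> \<Omega> k \<le> \<Omega> m)"

definition almost_submultiplicative :: "(int \<Rightarrow> real) \<Rightarrow> bool" where
  "almost_submultiplicative \<Omega> \<longleftrightarrow>
     (\<exists>C>0. \<forall>k m. even k \<longrightarrow> even m \<longrightarrow> \<Omega> (k + m) \<le> C * \<Omega> k * \<Omega> m)"

definition slowly_increasing :: "(int \<Rightarrow> real) \<Rightarrow> bool" where
  "slowly_increasing \<omega> \<longleftrightarrow> bdd_above ((\<lambda>k. \<omega> (2 * k) / \<omega> k) ` {k. even k \<and> k > 0})"


section \<open>Periodic distributions and the weighted space\<close>

definition vderiv :: "(real \<Rightarrow> complex) \<Rightarrow> real \<Rightarrow> complex" where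
  "vderiv \<phi> = (\<lambda>x. vector_derivative \<phi> (at x))"

definition periodic_test_function :: "(real \<Rightarrow> complex) \<Rightarrow> bool" where
  "periodic_test_function \<phi> \<longleftrightarrow>
     (\<forall>j x. (vderiv ^^ j) \<phi> differentiable (at x)) \<and> (\<forall>x. \<phi> (x + pi) = \<phi> x)"

text \<open>
  The last conjunct is continuity with respect to the usual Frechet topology on the smooth
  \<open>\<pi>\<close>-periodic functions. The values of \<open>v\<close> at other functions are irrelevant. The pairing is
  normalised so that a \<open>\<pi>\<close>-periodic locally integrable function \<open>f\<close> corresponds to
  \<open>\<phi> \<mapsto> \<integral> f(x) \<phi>(x) dx\<close>, the integral being over one period.
\<close>

definition periodic_distribution :: "((real \<Rightarrow> complex) \<Rightarrow> complex) \<Rightarrow> bool" where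
  "periodic_distribution v \<longleftrightarrow>
     (\<forall>\<phi> \<psi>. periodic_test_function \<phi> \<longrightarrow> periodic_test_function \<psi> \<longrightarrow>
        v (\<lambda>x. \<phi> x + \<psi> x) = v \<phi> + v \<psi>) \<and>
     (\<forall>c \<phi>. periodic_test_function \<phi> \<longrightarrow> v (\<lambda>x. c * \<phi> x) = c * v \<phi>) \<and>
     (\<exists>C N. \<forall>\<phi>. periodic_test_function \<phi> \<longrightarrow>
        norm (v \<phi>) \<le> C * (\<Sum>j\<le>N. SUP x. norm ((vderiv ^^ j) \<phi> x)))"

text \<open>
  Intended for even \<open>k\<close>. The factor \<open>1/\<pi>\<close> makes these the coefficients in the expansion
  \<open>v(x) = \<Sum> V(k) e\<^sup>i\<^sup>k\<^sup>x\<close>, which every periodic distribution has.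
\<close>

definition fourier_coeff :: "((real \<Rightarrow> complex) \<Rightarrow> complex) \<Rightarrow> int \<Rightarrow> complex" where
  "fourier_coeff v k = v (\<lambda>x. exp (- (\<i> * of_int k * of_real x))) / of_real pi"

definition W_infty :: "(int \<Rightarrow> real) \<Rightarrow> ((real \<Rightarrow> complex) \<Rightarrow> complex) set" where
  "W_infty \<Omega> =
     {v. periodic_distribution v \<and>
         bdd_above ((\<lambda>k. norm (fourier_coeff v k) * \<Omega> k) ` {k. even k})}"


section \<open>The functionals\<close>

definition admissible_indices :: "nat \<Rightarrow> int set" where
  "admissible_indices n = {j. even (j - int n)} - {int n, - int n}"

text \<open>\<open>V(a - j\<^sub>1) V(j\<^sub>1 - j\<^sub>2) \<cdots> V(j\<^sub>k - b)\<close> for the list \<open>[j\<^sub>1, \<dots>, j\<^sub>k]\<close>\<close>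

fun path_prod :: "(int \<Rightarrow> complex) \<Rightarrow> int \<Rightarrow> int list \<Rightarrow> int \<Rightarrow> complex" where
  "path_prod V a [] b = V (a - b)"
| "path_prod V a (j # js) b = V (a - j) * path_prod V j js b"

definition S_sum ::
  "(int \<Rightarrow> complex) \<Rightarrow> int \<Rightarrow> int \<Rightarrow> nat \<Rightarrow> nat \<Rightarrow> complex \<Rightarrow> complex" where
  "S_sum V a b k n z =
     (\<Sum>\<^sub>\<infinity>js\<in>{js. length js = k \<and> set js \<subseteq> admissible_indices n}.
        path_prod V a js b / (\<Prod>j\<leftarrow>js. (of_int ((int n)\<^sup>2 - j\<^sup>2) + z)))"

definition S12 :: "((real \<Rightarrow> complex) \<Rightarrow> complex) \<Rightarrow> nat \<Rightarrow> nat \<Rightarrow> complex \<Rightarrow> complex" where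
  "S12 v k n z = S_sum (fourier_coeff v) (- int n) (int n) k n z"

definition S21 :: "((real \<Rightarrow> complex) \<Rightarrow> complex) \<Rightarrow> nat \<Rightarrow> nat \<Rightarrow> complex \<Rightarrow> complex" where
  "S21 v k n z = S_sum (fourier_coeff v) (int n) (- int n) k n z"

text \<open>
  For a distribution with bounded Fourier coefficients all the sums converge absolutely once \<open>n\<close>
  is large and \<open>norm z < n\<close>; only this range is meaningful.
\<close>

definition beta_minus :: "((real \<Rightarrow> complex) \<Rightarrow> complex) \<Rightarrow> nat \<Rightarrow> complex \<Rightarrow> complex" where
  "beta_minus v n z = fourier_coeff v (- 2 * int n) + (\<Sum>k. S12 v (Suc k) n z)"

definition beta_plus :: "((real \<Rightarrow> complex) \<Rightarrow> complex) \<Rightarrow> nat \<Rightarrow> complex \<Rightarrow> complex" where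
  "beta_plus v n z = fourier_coeff v (2 * int n) + (\<Sum>k. S21 v (Suc k) n z)"


section \<open>Asymptotics along a set of indices\<close>

abbreviation at_top_in :: "nat set \<Rightarrow> nat filter" where
  "at_top_in \<Delta> \<equiv> inf sequentially (principal \<Delta>)"

text \<open>
  The supremum is taken in \<^typ>\<open>ennreal\<close>, where it exists without a boundedness assumption.
\<close>

definition unif_asymp_equiv :: "nat set \<Rightarrow> (nat \<Rightarrow> complex \<Rightarrow> complex) \<Rightarrow> (nat \<Rightarrow> complex) \<Rightarrow> bool" where
  "unif_asymp_equiv \<Delta> b a \<longleftrightarrow>
     ((\<lambda>n. SUP z\<in>cball 0 (real n / 2). ennreal (norm (b n z / a n - 1))) \<longlongrightarrow> 0) (at_top_in \<Delta>)"

end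

theory Submission
  imports Defs
begin

text \<open>
  The terms of \<open>\<beta>\<^sub>n\<^sup>\<pm>(v,z) - V(\<pm>2n)\<close> run over paths from \<open>\<pm>n\<close> to \<open>\<mp>n\<close>, so the steps of a path
  add up to \<open>\<pm>2n\<close>.  Bounding each coefficient by \<open>M/\<Omega>\<close>, almost submultiplicativity lets one
  pull a single factor \<open>1/\<Omega>'(2n)\<close> out of the product.  A slowly increasing weight satisfies
  \<open>\<omega>(k+m) \<le> L (\<omega>(k) + \<omega>(m))\<close>, so \<open>1/\<omega>(2n)\<close> can be pulled out as well, at the price of losing the
  decay \<open>1/\<omega>\<close> in one step of the path
  (lemma \<open>path_prod_le\<close>).  Losing one step is harmless: cutting the path there leaves two chains of
  alternating factors \<open>1/\<omega>(step)\<close> and \<open>1/|n\<^sup>2 - j\<^sup>2|\<close>, one starting at each fixed end point,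
  and each chain is summed from its free end to its fixed end.  Every summation costs only
  \[ \sum_{j} \frac{1}{|n^2-j^2|\,\omega(a-j)} \le \frac{2K+1}{n}, \]
  uniformly in \<open>a \<equiv> n\<close> modulo \<open>2\<close>, because \<open>\<omega>\<close> is monotone and \<open>\<Sum> 1/(|k| \<omega>(k))\<close> converges
  (lemma \<open>resolvent_kernel_le\<close>).  Hence \<open>|S\<^sub>k| \<le> M (D/n)\<^sup>k / \<Omega>(2n)\<close> for a constant \<open>D\<close>.

  All terms with \<open>k \<ge> 2\<close> together are therefore \<open>O(1/(n\<^sup>2 \<Omega>(2n)))\<close>, and \<open>S\<^sub>1\<close> is \<open>O(1/(n \<Omega>(2n)))\<close>.
  Moreover one of the two steps of a path counted by \<open>S\<^sub>1\<close> has length at least \<open>n\<close>, so \<open>S\<^sub>1\<close> is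
  even \<open>O(\<rho>/(n \<Omega>(2n)))\<close>, where \<open>\<rho>\<close> bounds \<open>|V(k)| \<Omega>(k)\<close> for \<open>|k| \<ge> n\<close>.
  Thus \<open>n \<Omega>(2n) |\<beta>\<^sub>n\<^sup>\<pm> - V(\<pm>2n)| \<le> D \<rho> + O(1/n)\<close>, which is bounded in
  general and tends to zero when \<open>V(k) \<Omega>(k) \<rightarrow> 0\<close>; these are the two cases of the theorem.
\<close>

section \<open>Sums over lists\<close>

lemma sum_lists_Suc:
  fixes f :: "'a list \<Rightarrow> 'b :: comm_monoid_add"
  shows "(\<Sum>js | set js \<subseteq> J \<and> length js = Suc k. f js)
       = (\<Sum>j\<in>J. \<Sum>js | set js \<subseteq> J \<and> length js = k. f (j # js))"
proof -
  have "(\<Sum>js | set js \<subseteq> J \<and> length js = Suc k. f js)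
      = (\<Sum>(js, j)\<in>{js. set js \<subseteq> J \<and> length js = k} \<times> J. f (j # js))"
    unfolding lists_length_Suc_eq
    by (subst sum.reindex) (auto simp: inj_on_def case_prod_unfold)
  also have "\<dots> = (\<Sum>js | set js \<subseteq> J \<and> length js = k. \<Sum>j\<in>J. f (j # js))"
    by (simp add: sum.cartesian_product)
  also have "\<dots> = (\<Sum>j\<in>J. \<Sum>js | set js \<subseteq> J \<and> length js = k. f (j # js))"
    by (rule sum.swap)
  finally show ?thesis .
qed

text \<open>
  It suffices to bound the sums over lists with entries in a finite alphabet: finitely many lists
  have only finitely many entries.
\<close>

lemma norm_infsum_lists_le:
  fixes f :: "'a list \<Rightarrow> 'b :: banach"
  assumes bound: "\<And>J. finite J \<Longrightarrow> J \<subseteq> A \<Longrightarrow>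
                    (\<Sum>js | set js \<subseteq> J \<and> length js = k. norm (f js)) \<le> B"
  shows "norm (\<Sum>\<^sub>\<infinity>js\<in>{js. length js = k \<and> set js \<subseteq> A}. f js) \<le> B"
proof -
  let ?X = "{js. length js = k \<and> set js \<subseteq> A}"
  have fin: "sum (\<lambda>js. norm (f js)) F \<le> B" if F: "finite F" "F \<subseteq> ?X" for F
  proof -
    let ?J = "\<Union> (set ` F)"
    have "finite ?J" "?J \<subseteq> A" using F by auto
    moreover have "sum (\<lambda>js. norm (f js)) F
        \<le> (\<Sum>js | set js \<subseteq> ?J \<and> length js = k. norm (f js))"
      by (rule sum_mono2) (use F \<open>finite ?J\<close> in \<open>auto simp: finite_lists_length_eq\<close>)
    ultimately show ?thesis using bound[of ?J] by linarith
  qed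
  have summable: "(\<lambda>js. norm (f js)) summable_on ?X"
    by (rule nonneg_bdd_above_summable_on) (auto intro!: bdd_aboveI2 fin)
  have "norm (infsum f ?X) \<le> (\<Sum>\<^sub>\<infinity>js\<in>?X. norm (f js))"
    by (rule norm_infsum_bound) (use summable in simp)
  also have "\<dots> \<le> B"
    by (rule infsum_le_finite_sums[OF summable fin])
  finally show ?thesis .
qed

section \<open>Path sums for a symmetric kernel\<close>

fun kernel_prod :: "('a \<Rightarrow> 'a \<Rightarrow> real) \<Rightarrow> 'a \<Rightarrow> 'a list \<Rightarrow> 'a \<Rightarrow> real" where
  "kernel_prod w a [] b = w a b"
| "kernel_prod w a (j # js) b = w a j * kernel_prod w j js b"

text \<open>
  With \<open>s\<^sub>0, \<dots>, s\<^sub>k\<close> the values of \<open>w\<close> along the steps of the path, this is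
  \<open>\<Sum>\<^sub>i \<Prod>\<^bsub>m \<noteq> i\<^esub> s\<^sub>m\<close>.
\<close>

fun omit_one_sum :: "('a \<Rightarrow> 'a \<Rightarrow> real) \<Rightarrow> 'a \<Rightarrow> 'a list \<Rightarrow> 'a \<Rightarrow> real" where
  "omit_one_sum w a [] b = 1"
| "omit_one_sum w a (j # js) b = kernel_prod w j js b + w a j * omit_one_sum w j js b"

lemma kernel_prod_nonneg:
  assumes "\<And>x y. x \<in> P \<Longrightarrow> y \<in> P \<Longrightarrow> 0 \<le> w x y"
  shows "a \<in> P \<Longrightarrow> b \<in> P \<Longrightarrow> set js \<subseteq> P \<Longrightarrow> 0 \<le> kernel_prod w a js b"
  by (induction js arbitrary: a) (auto simp: assms)

lemma omit_one_sum_nonneg: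
  assumes "\<And>x y. x \<in> P \<Longrightarrow> y \<in> P \<Longrightarrow> 0 \<le> w x y"
  shows "a \<in> P \<Longrightarrow> b \<in> P \<Longrightarrow> set js \<subseteq> P \<Longrightarrow> 0 \<le> omit_one_sum w a js b"
  by (induction js arbitrary: a)
     (auto simp: assms intro!: add_nonneg_nonneg kernel_prod_nonneg[where P = P, OF assms])

locale summable_kernel =
  fixes w :: "'a \<Rightarrow> 'a \<Rightarrow> real" and h :: "'a \<Rightarrow> real" and P J :: "'a set" and \<kappa> :: real
  assumes J_subset: "J \<subseteq> P"
    and w_sym: "\<And>x y. x \<in> P \<Longrightarrow> y \<in> P \<Longrightarrow> w x y = w y x"
    and w_nonneg: "\<And>x y. x \<in> P \<Longrightarrow> y \<in> P \<Longrightarrow> 0 \<le> w x y"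
    and h_nonneg: "\<And>j. j \<in> J \<Longrightarrow> 0 \<le> h j"
    and kernel_bound: "\<And>a. a \<in> P \<Longrightarrow> (\<Sum>j\<in>J. h j * w a j) \<le> \<kappa>"
    and \<kappa>_nonneg: "0 \<le> \<kappa>"
begin

lemma h_prod_nonneg: "set js \<subseteq> J \<Longrightarrow> 0 \<le> (\<Prod>i\<leftarrow>js. h i)"
  by (induction js) (auto simp: h_nonneg)

text \<open>
  The free end of the path is \<open>j\<close>; it is summed first, which by symmetry of \<open>w\<close> costs a factor
  \<open>\<kappa>\<close> and frees the next vertex.
\<close>

lemma sum_kernel_prod_free_start_le:
  assumes "b \<in> P"
  shows "(\<Sum>j\<in>J. h j * (\<Sum>js | set js \<subseteq> J \<and> length js = k.
            (\<Prod>i\<leftarrow>js. h i) * kernel_prod w j js b)) \<le> \<kappa> ^ Suc k"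
proof (induction k)
  case 0
  have "{js. set js \<subseteq> J \<and> js = []} = {[]}" by auto
  moreover have "(\<Sum>j\<in>J. h j * w j b) = (\<Sum>j\<in>J. h j * w b j)"
    by (intro sum.cong) (use assms J_subset w_sym in auto)
  ultimately show ?case using kernel_bound[OF assms] by simp
next
  case (Suc k)
  let ?T = "\<lambda>i. \<Sum>js | set js \<subseteq> J \<and> length js = k. (\<Prod>i\<leftarrow>js. h i) * kernel_prod w i js b"
  have T_nonneg: "0 \<le> ?T i" if "i \<in> J" for i
    using that J_subset assms
    by (intro sum_nonneg mult_nonneg_nonneg h_prod_nonneg kernel_prod_nonneg[where P = P])
       (auto simp: w_nonneg)
  have "(\<Sum>j\<in>J. h j * (\<Sum>js | set js \<subseteq> J \<and> length js = Suc k.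
            (\<Prod>i\<leftarrow>js. h i) * kernel_prod w j js b))
      = (\<Sum>j\<in>J. \<Sum>i\<in>J. (h j * w i j) * (h i * ?T i))"
    unfolding sum_lists_Suc sum_distrib_left
    by (intro sum.cong refl) (use J_subset w_sym in \<open>auto simp: mult_ac subset_iff\<close>)
  also have "\<dots> = (\<Sum>i\<in>J. (\<Sum>j\<in>J. h j * w i j) * (h i * ?T i))"
    by (subst sum.swap) (simp add: sum_distrib_right)
  also have "\<dots> \<le> (\<Sum>i\<in>J. \<kappa> * (h i * ?T i))"
    by (intro sum_mono mult_right_mono kernel_bound mult_nonneg_nonneg h_nonneg T_nonneg)
       (use J_subset in auto)
  also have "\<dots> = \<kappa> * (\<Sum>i\<in>J. h i * ?T i)" by (simp add: sum_distrib_left)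
  also have "\<dots> \<le> \<kappa> * \<kappa> ^ Suc k" by (intro mult_left_mono Suc.IH \<kappa>_nonneg)
  finally show ?case by simp
qed

text \<open>
  Omitting one step cuts the path into two chains that each have only one end fixed, so no
  power of \<open>\<kappa>\<close> is lost; \<open>k + 1\<close> counts the steps that can be omitted.
\<close>

lemma sum_omit_one_le:
  assumes "a \<in> P" "b \<in> P"
  shows "(\<Sum>js | set js \<subseteq> J \<and> length js = k. (\<Prod>i\<leftarrow>js. h i) * omit_one_sum w a js b)
           \<le> (real k + 1) * \<kappa> ^ k"
  using assms(1)
proof (induction k arbitrary: a)
  case 0
  have "{js. set js \<subseteq> J \<and> js = []} = {[]}" by auto
  then show ?case by simp
next
  case (Suc k)
  let ?L = "{js. set js \<subseteq> J \<and> length js = k}"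
  let ?G = "\<lambda>j. \<Sum>js\<in>?L. (\<Prod>i\<leftarrow>js. h i) * omit_one_sum w j js b"
  have "(\<Sum>js | set js \<subseteq> J \<and> length js = Suc k. (\<Prod>i\<leftarrow>js. h i) * omit_one_sum w a js b)
      = (\<Sum>j\<in>J. h j * (\<Sum>js\<in>?L. (\<Prod>i\<leftarrow>js. h i) * kernel_prod w j js b))
        + (\<Sum>j\<in>J. (h j * w a j) * ?G j)"
    unfolding sum_lists_Suc sum_distrib_left
    by (simp add: sum.distrib[symmetric] algebra_simps)
  also have "\<dots> \<le> \<kappa> ^ Suc k + (\<Sum>j\<in>J. (h j * w a j) * ((real k + 1) * \<kappa> ^ k))"
    by (intro add_mono sum_kernel_prod_free_start_le assms(2) sum_mono mult_left_mono Suc.IH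
              mult_nonneg_nonneg h_nonneg w_nonneg) (use J_subset Suc.prems in auto)
  also have "(\<Sum>j\<in>J. (h j * w a j) * ((real k + 1) * \<kappa> ^ k))
           = (\<Sum>j\<in>J. h j * w a j) * ((real k + 1) * \<kappa> ^ k)"
    by (simp only: sum_distrib_right)
  also have "\<dots> \<le> \<kappa> * ((real k + 1) * \<kappa> ^ k)"
    by (intro mult_right_mono kernel_bound Suc.prems) (simp add: \<kappa>_nonneg)
  finally show ?case by (simp add: algebra_simps)
qed

end

section \<open>The resolvent denominators\<close>

text \<open>
  One of the factors of \<open>\<bar>n - j\<bar> \<bar>n + j\<bar>\<close> is at least \<open>n\<close> and the other at least \<open>1\<close>, so
  \<open>\<bar>z\<bar> \<le> n/2\<close> is at most half of \<open>\<bar>n\<^sup>2 - j\<^sup>2\<bar>\<close>.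
\<close>

lemma norm_resolvent_le:
  assumes n: "n \<ge> 1" and j: "j \<in> admissible_indices n" and z: "norm z \<le> real n / 2"
  shows "1 / norm (of_int ((int n)\<^sup>2 - j\<^sup>2) + z :: complex)
           \<le> 2 * (1 / \<bar>real_of_int ((int n)\<^sup>2 - j\<^sup>2)\<bar>)"
proof -
  have "j \<noteq> int n" "j \<noteq> - int n" using j by (auto simp: admissible_indices_def)
  then have factors: "\<bar>int n - j\<bar> \<ge> 1" "\<bar>int n + j\<bar> \<ge> 1" by auto
  have "int n \<le> \<bar>int n - j\<bar> * \<bar>int n + j\<bar>"
  proof (cases "\<bar>int n - j\<bar> \<ge> int n")
    case True
    then show ?thesis using mult_mono[of "int n" "\<bar>int n - j\<bar>" 1 "\<bar>int n + j\<bar>"] factors by simp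
  next
    case False
    then have "\<bar>int n + j\<bar> \<ge> int n" by linarith
    then show ?thesis using mult_mono[of 1 "\<bar>int n - j\<bar>" "int n" "\<bar>int n + j\<bar>"] factors by simp
  qed
  also have "\<dots> = \<bar>(int n)\<^sup>2 - j\<^sup>2\<bar>"
    unfolding abs_mult[symmetric] by (rule arg_cong[of _ _ abs]) (simp add: power2_eq_square algebra_simps)
  finally have "int n \<le> \<bar>(int n)\<^sup>2 - j\<^sup>2\<bar>" .
  moreover define d where "d = (int n)\<^sup>2 - j\<^sup>2"
  ultimately have d: "real n \<le> \<bar>real_of_int d\<bar>" by linarith
  have "\<bar>real_of_int d\<bar> - norm z \<le> norm (of_int d + z :: complex)"
    using norm_diff_ineq[of "of_int d :: complex" z] by (simp only: norm_of_int)
  then have "\<bar>real_of_int d\<bar> / 2 \<le> norm (of_int d + z :: complex)"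
    using d z by linarith
  moreover have "0 < \<bar>real_of_int d\<bar> / 2" using d n by linarith
  ultimately have "1 / norm (of_int d + z :: complex) \<le> 1 / (\<bar>real_of_int d\<bar> / 2)"
    by (rule frac_le[OF zero_le_one order_refl, rotated -1])
  then show ?thesis unfolding d_def by simp
qed

lemma norm_resolvent_prod_le:
  assumes n: "n \<ge> 1" and z: "norm z \<le> real n / 2" and js: "set js \<subseteq> admissible_indices n"
  shows "1 / norm (\<Prod>j\<leftarrow>js. (of_int ((int n)\<^sup>2 - j\<^sup>2) + z :: complex))
           \<le> 2 ^ length js * (\<Prod>j\<leftarrow>js. 1 / \<bar>real_of_int ((int n)\<^sup>2 - j\<^sup>2)\<bar>)"
  using js
proof (induction js)
  case Nil
  then show ?case by simp
next
  case (Cons j js)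
  let ?d = "\<lambda>j. of_int ((int n)\<^sup>2 - j\<^sup>2) + z :: complex"
  let ?h = "\<lambda>j. 1 / \<bar>real_of_int ((int n)\<^sup>2 - j\<^sup>2)\<bar>"
  have "1 / norm (\<Prod>j\<leftarrow>j # js. ?d j) = (1 / norm (?d j)) * (1 / norm (\<Prod>j\<leftarrow>js. ?d j))"
    by (simp only: list.map prod_list.Cons norm_mult) simp
  also have "\<dots> \<le> (2 * ?h j) * (2 ^ length js * (\<Prod>j\<leftarrow>js. ?h j))"
    using Cons by (intro mult_mono norm_resolvent_le n z) auto
  finally show ?case by (simp add: mult_ac)
qed

section \<open>Weights that factor\<close>

locale factored_weight =
  fixes \<Omega> \<omega> \<Omega>' :: "int \<Rightarrow> real" and C L K :: real
  assumes factor: "\<And>k. even k \<Longrightarrow> \<Omega> k = \<omega> k * \<Omega>' k"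
    and \<omega>_sym: "\<And>k. even k \<Longrightarrow> \<omega> (- k) = \<omega> k"
    and \<omega>_ge_1: "\<And>k. even k \<Longrightarrow> 1 \<le> \<omega> k"
    and \<omega>_mono: "\<And>k m. even k \<Longrightarrow> even m \<Longrightarrow> \<bar>k\<bar> \<le> \<bar>m\<bar> \<Longrightarrow> \<omega> k \<le> \<omega> m"
    and \<omega>_add_le: "\<And>k m. even k \<Longrightarrow> even m \<Longrightarrow> \<omega> (k + m) \<le> L * (\<omega> k + \<omega> m)"
    and \<Omega>'_pos: "\<And>k. even k \<Longrightarrow> 0 < \<Omega>' k"
    and \<Omega>'_add_le: "\<And>k m. even k \<Longrightarrow> even m \<Longrightarrow> \<Omega>' (k + m) \<le> C * \<Omega>' k * \<Omega>' m"
    and C_pos: "0 < C" and L_ge_1: "1 \<le> L"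
    and \<omega>_sum_le: "\<And>F. finite F \<Longrightarrow> F \<subseteq> {k. even k \<and> k \<noteq> 0} \<Longrightarrow>
                      (\<Sum>k\<in>F. 1 / (\<bar>real_of_int k\<bar> * \<omega> k)) \<le> K"
begin

lemma \<omega>_pos: "even k \<Longrightarrow> 0 < \<omega> k"
  using \<omega>_ge_1[of k] by linarith

lemma \<Omega>_pos: "even k \<Longrightarrow> 0 < \<Omega> k"
  by (simp add: factor \<omega>_pos \<Omega>'_pos)

lemma K_nonneg: "0 \<le> K"
  using \<omega>_sum_le[of "{}"] by simp

lemma \<omega>_sum_translate_le:
  assumes "finite J" "\<And>j. j \<in> J \<Longrightarrow> even (c - j)"
  shows "(\<Sum>j\<in>J. 1 / (\<bar>real_of_int (c - j)\<bar> * \<omega> (c - j))) \<le> K"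
proof -
  \<comment> \<open>The summand at \<open>j = c\<close> is \<open>1 / 0 = 0\<close>.\<close>
  have "(\<Sum>j\<in>J. 1 / (\<bar>real_of_int (c - j)\<bar> * \<omega> (c - j)))
      = (\<Sum>j\<in>J - {c}. 1 / (\<bar>real_of_int (c - j)\<bar> * \<omega> (c - j)))"
    by (rule sum.mono_neutral_right) (use assms in auto)
  also have "\<dots> = (\<Sum>k\<in>(\<lambda>j. c - j) ` (J - {c}). 1 / (\<bar>real_of_int k\<bar> * \<omega> k))"
    by (subst sum.reindex) (auto simp: inj_on_def)
  also have "\<dots> \<le> K"
    by (rule \<omega>_sum_le) (use assms in auto)
  finally show ?thesis .
qed

text \<open>
  Whichever of \<open>\<bar>a - j\<bar>\<close> and \<open>\<bar>c - j\<bar>\<close> is smaller may replace the other, since both factors decay;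
  only \<open>j = a\<close> escapes this comparison, and it contributes at most \<open>1\<close>.
\<close>

lemma shifted_kernel_le:
  assumes J: "finite J" "\<And>j. j \<in> J \<Longrightarrow> even (c - j)" "c \<notin> J" and a: "even (a - c)"
  shows "(\<Sum>j\<in>J. 1 / (\<bar>real_of_int (c - j)\<bar> * \<omega> (a - j))) \<le> 2 * K + 1"
proof -
  let ?\<phi> = "\<lambda>k. 1 / (\<bar>real_of_int k\<bar> * \<omega> k)"
  have ev: "even (a - j)" if "j \<in> J" for j
    using J(2)[OF that] a by presburger
  have \<phi>_nonneg: "0 \<le> ?\<phi> k" if "even k" for k
    using \<omega>_pos[OF that] by simp
  have "1 / (\<bar>real_of_int (c - j)\<bar> * \<omega> (a - j))
      \<le> ?\<phi> (c - j) + ?\<phi> (a - j) + (if j = a then 1 else 0)" if j: "j \<in> J" for j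
  proof -
    note pos = \<omega>_pos[OF ev[OF j]] \<omega>_pos[OF J(2)[OF j]]
    have nonneg: "0 \<le> ?\<phi> (a - j)" "0 \<le> ?\<phi> (c - j)" "0 \<le> (if j = a then 1 else 0 :: real)"
      using \<phi>_nonneg[OF ev[OF j]] \<phi>_nonneg[OF J(2)[OF j]] by auto
    have cj: "\<bar>c - j\<bar> \<ge> 1" using J(3) j by (cases "c = j") auto
    then have cj': "\<bar>real_of_int (c - j)\<bar> \<ge> 1" by linarith
    consider "\<bar>c - j\<bar> \<le> \<bar>a - j\<bar>" | "\<bar>a - j\<bar> \<le> \<bar>c - j\<bar>" "a \<noteq> j" | "a = j" by linarith
    then show ?thesis
    proof cases
      case 1
      then have "\<omega> (c - j) \<le> \<omega> (a - j)" by (intro \<omega>_mono J(2) ev j)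
      then have "1 / (\<bar>real_of_int (c - j)\<bar> * \<omega> (a - j)) \<le> ?\<phi> (c - j)"
        using cj' pos by (intro divide_left_mono mult_left_mono mult_pos_pos) auto
      then show ?thesis using nonneg by linarith
    next
      case 2
      have "\<bar>real_of_int (a - j)\<bar> > 0" using 2 by simp
      moreover have "\<bar>real_of_int (a - j)\<bar> \<le> \<bar>real_of_int (c - j)\<bar>" using 2 by linarith
      ultimately have "1 / (\<bar>real_of_int (c - j)\<bar> * \<omega> (a - j)) \<le> ?\<phi> (a - j)"
        using cj' pos by (intro divide_left_mono mult_right_mono mult_pos_pos) auto
      then show ?thesis using nonneg by linarith
    next
      case 3
      have "1 * 1 \<le> \<bar>real_of_int (c - j)\<bar> * \<omega> (a - j)"
        using cj' \<omega>_ge_1[OF ev[OF j]] by (intro mult_mono) auto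
      then have "1 / (\<bar>real_of_int (c - j)\<bar> * \<omega> (a - j)) \<le> 1" by simp
      moreover have "(if j = a then 1 else 0 :: real) = 1" using 3 by simp
      ultimately show ?thesis using nonneg by linarith
    qed
  qed
  then have "(\<Sum>j\<in>J. 1 / (\<bar>real_of_int (c - j)\<bar> * \<omega> (a - j)))
      \<le> (\<Sum>j\<in>J. ?\<phi> (c - j)) + (\<Sum>j\<in>J. ?\<phi> (a - j)) + (\<Sum>j\<in>J. if j = a then 1 else 0)"
    by (simp only: sum.distrib[symmetric]) (rule sum_mono)
  also have "\<dots> \<le> K + K + 1"
    using J(1) ev by (intro add_mono \<omega>_sum_translate_le J) (auto simp: sum.delta)
  finally show ?thesis by simp
qed

text \<open>
  Partial fractions: \<open>2n \<le> \<bar>n - j\<bar> + \<bar>n + j\<bar>\<close> turns the product \<open>1/(\<bar>n - j\<bar> \<bar>n + j\<bar>)\<close> into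
  \<open>1/(2n)\<close> times a sum of two simple poles.
\<close>

lemma resolvent_kernel_le:
  assumes n: "n \<ge> 1" and J: "finite J" "J \<subseteq> admissible_indices n" and a: "even (a - int n)"
  shows "(\<Sum>j\<in>J. 1 / \<bar>real_of_int ((int n)\<^sup>2 - j\<^sup>2)\<bar> * (1 / \<omega> (a - j))) \<le> (2 * K + 1) / real n"
proof -
  let ?s = "\<lambda>c j. 1 / (\<bar>real_of_int (c - j)\<bar> * \<omega> (a - j))"
  have "1 / \<bar>real_of_int ((int n)\<^sup>2 - j\<^sup>2)\<bar> * (1 / \<omega> (a - j))
      \<le> 1 / (2 * real n) * (?s (int n) j + ?s (- int n) j)" if "j \<in> J" for j
  proof -
    have j: "even (j - int n)" "j \<noteq> int n" "j \<noteq> - int n"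
      using that J(2) by (auto simp: admissible_indices_def)
    define x y where "x = \<bar>real_of_int (int n - j)\<bar>" and "y = \<bar>real_of_int (- int n - j)\<bar>"
    have "even (a - j)" using j(1) a by presburger
    then have \<omega>: "0 < \<omega> (a - j)" by (rule \<omega>_pos)
    have "(int n)\<^sup>2 - j\<^sup>2 = (int n - j) * (- (- int n - j))"
      by (simp add: power2_eq_square algebra_simps)
    then have xy: "\<bar>real_of_int ((int n)\<^sup>2 - j\<^sup>2)\<bar> = x * y"
      by (simp add: x_def y_def abs_mult del: minus_diff_eq)
    have x: "0 < x" and y: "0 < y" using j by (auto simp: x_def y_def)
    have "2 * real n \<le> x + y" by (simp add: x_def y_def)
    then have "1 / (x * y) \<le> 1 / (2 * real n) * (1 / x + 1 / y)"
      using x y n by (simp add: field_simps)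
    then have "1 / (x * y) * (1 / \<omega> (a - j)) \<le> 1 / (2 * real n) * (1 / x + 1 / y) * (1 / \<omega> (a - j))"
      using \<omega> by (intro mult_right_mono) auto
    also have "\<dots> = 1 / (2 * real n) * (1 / (x * \<omega> (a - j)) + 1 / (y * \<omega> (a - j)))"
      using x y \<omega> by (simp add: field_simps)
    finally show ?thesis unfolding xy by (simp add: x_def y_def)
  qed
  then have "(\<Sum>j\<in>J. 1 / \<bar>real_of_int ((int n)\<^sup>2 - j\<^sup>2)\<bar> * (1 / \<omega> (a - j)))
      \<le> 1 / (2 * real n) * ((\<Sum>j\<in>J. ?s (int n) j) + (\<Sum>j\<in>J. ?s (- int n) j))"
    by (simp only: sum.distrib[symmetric] sum_distrib_left) (rule sum_mono)
  also have "\<dots> \<le> 1 / (2 * real n) * ((2 * K + 1) + (2 * K + 1))"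
    using J a by (intro mult_left_mono add_mono shifted_kernel_le)
                 (auto simp: admissible_indices_def)
  also have "\<dots> = (2 * K + 1) / real n" using n by (simp add: field_simps)
  finally show ?thesis .
qed

lemma kernel_summable_kernel:
  assumes "n \<ge> 1" "finite J" "J \<subseteq> admissible_indices n"
  shows "summable_kernel (\<lambda>i j. 1 / \<omega> (i - j)) (\<lambda>j. 1 / \<bar>real_of_int ((int n)\<^sup>2 - j\<^sup>2)\<bar>)
           {j. even (j - int n)} J ((2 * K + 1) / real n)"
proof
  show "J \<subseteq> {j. even (j - int n)}" using assms(3) by (auto simp: admissible_indices_def)
next
  fix x y :: int
  assume "x \<in> {j. even (j - int n)}" "y \<in> {j. even (j - int n)}"
  then have ev: "even (x - y)" by auto
  show "1 / \<omega> (x - y) = 1 / \<omega> (y - x)" using \<omega>_sym[OF ev] by simp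
  show "0 \<le> 1 / \<omega> (x - y)" using \<omega>_pos[OF ev] by simp
next
  fix a assume "a \<in> {j. even (j - int n)}"
  then show "(\<Sum>j\<in>J. 1 / \<bar>real_of_int ((int n)\<^sup>2 - j\<^sup>2)\<bar> * (1 / \<omega> (a - j))) \<le> (2 * K + 1) / real n"
    by (intro resolvent_kernel_le assms) auto
qed (use K_nonneg in auto)

end

section \<open>Estimates of the path products\<close>

locale bounded_coeffs = factored_weight +
  fixes V :: "int \<Rightarrow> complex" and M :: real
  assumes V_bound: "\<And>k. even k \<Longrightarrow> norm (V k) * \<Omega> k \<le> M"
    and M_pos: "0 < M"
begin

lemma V_\<Omega>'_le: "even k \<Longrightarrow> norm (V k) * \<Omega>' k \<le> M * (1 / \<omega> k)"
  using V_bound[of k] \<omega>_pos[of k] by (simp add: factor field_simps)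

lemma \<Omega>'_path_prod_le:
  assumes "even (a - b)" "\<forall>j\<in>set js. even (j - b)"
  shows "\<Omega>' (a - b) * norm (path_prod V a js b)
           \<le> M * (M * C) ^ length js * kernel_prod (\<lambda>i j. 1 / \<omega> (i - j)) a js b"
  using assms
proof (induction js arbitrary: a)
  case Nil
  then show ?case using V_\<Omega>'_le[of "a - b"] by (simp add: mult_ac)
next
  case (Cons j js)
  have jb: "even (j - b)" and aj: "even (a - j)" using Cons.prems by auto
  have "\<Omega>' (a - b) \<le> C * \<Omega>' (a - j) * \<Omega>' (j - b)"
    using \<Omega>'_add_le[OF aj jb] by simp
  then have "\<Omega>' (a - b) * norm (path_prod V a (j # js) b)
      \<le> (C * \<Omega>' (a - j) * \<Omega>' (j - b)) * norm (path_prod V a (j # js) b)"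
    by (rule mult_right_mono) simp
  also have "\<dots> = C * (norm (V (a - j)) * \<Omega>' (a - j)) * (\<Omega>' (j - b) * norm (path_prod V j js b))"
    by (simp add: norm_mult)
  also have "\<dots> \<le> C * (M * (1 / \<omega> (a - j)))
      * (M * (M * C) ^ length js * kernel_prod (\<lambda>i j. 1 / \<omega> (i - j)) j js b)"
  proof (rule mult_mono)
    show "C * (norm (V (a - j)) * \<Omega>' (a - j)) \<le> C * (M * (1 / \<omega> (a - j)))"
      using V_\<Omega>'_le[OF aj] C_pos by (intro mult_left_mono) auto
    show "\<Omega>' (j - b) * norm (path_prod V j js b)
        \<le> M * (M * C) ^ length js * kernel_prod (\<lambda>i j. 1 / \<omega> (i - j)) j js b"
      by (rule Cons.IH) (use Cons.prems in auto)
    show "0 \<le> C * (M * (1 / \<omega> (a - j)))"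
      using C_pos M_pos \<omega>_pos[OF aj] by simp
    show "0 \<le> \<Omega>' (j - b) * norm (path_prod V j js b)"
      using \<Omega>'_pos[OF jb] by simp
  qed
  also have "\<dots> = M * (M * C) ^ length (j # js) * kernel_prod (\<lambda>i j. 1 / \<omega> (i - j)) a (j # js) b"
    by simp
  finally show ?case .
qed

text \<open>
  Splitting \<open>\<omega>(a - b) \<le> L (\<omega>(a - j) + \<omega>(j - b))\<close> at the first step \<open>a - j\<close>: the first summand
  cancels the factor \<open>1/\<omega>(a - j)\<close> of that step, the second one is passed on to the rest of the
  path.
\<close>

lemma path_prod_le:
  assumes "even (a - b)" "\<forall>j\<in>set js. even (j - b)"
  shows "\<Omega> (a - b) * norm (path_prod V a js b)
           \<le> M * (M * C * L) ^ length js * omit_one_sum (\<lambda>i j. 1 / \<omega> (i - j)) a js b"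
  using assms
proof (induction js arbitrary: a)
  case Nil
  then show ?case using V_bound[of "a - b"] by (simp add: mult_ac)
next
  case (Cons j js)
  let ?w = "\<lambda>i j. 1 / \<omega> (i - j)"
  let ?v = "norm (path_prod V j js b)"
  have jb: "even (j - b)" and aj: "even (a - j)" and rest: "\<forall>j\<in>set js. even (j - b)"
    using Cons.prems by auto
  have pos: "0 < \<omega> (a - j)" "0 < \<omega> (j - b)" "0 < \<Omega>' (a - j)" "0 < \<Omega>' (j - b)" "0 < \<omega> (a - b)"
    using aj jb Cons.prems by (auto simp only: \<omega>_pos \<Omega>'_pos)
  have q_nonneg: "0 \<le> kernel_prod ?w j js b"
    by (rule kernel_prod_nonneg[where P = "{i. even (i - b)}"])
       (use jb rest in \<open>auto intro!: less_imp_le[OF \<omega>_pos]\<close>)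
  have "\<Omega> (a - b) = \<omega> (a - b) * \<Omega>' (a - b)" by (rule factor) (rule Cons.prems)
  also have "\<dots> \<le> (L * (\<omega> (a - j) + \<omega> (j - b))) * (C * \<Omega>' (a - j) * \<Omega>' (j - b))"
    using \<omega>_add_le[OF aj jb] \<Omega>'_add_le[OF aj jb] pos Cons.prems(1)
    by (intro mult_mono) (auto intro!: mult_nonneg_nonneg less_imp_le[OF \<Omega>'_pos] add_nonneg_nonneg less_imp_le[OF order_less_le_trans[OF zero_less_one L_ge_1]])
  finally have "\<Omega> (a - b) * norm (path_prod V a (j # js) b)
      \<le> (L * (\<omega> (a - j) + \<omega> (j - b))) * (C * \<Omega>' (a - j) * \<Omega>' (j - b)) * norm (path_prod V a (j # js) b)"
    by (rule mult_right_mono) simp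
  also have "\<dots> = L * C * (norm (V (a - j)) * \<Omega>' (a - j)) * ((\<omega> (a - j) + \<omega> (j - b)) * \<Omega>' (j - b) * ?v)"
    by (simp add: norm_mult)
  also have "\<dots> \<le> L * C * (M * (1 / \<omega> (a - j))) * ((\<omega> (a - j) + \<omega> (j - b)) * \<Omega>' (j - b) * ?v)"
    using L_ge_1 C_pos pos by (intro mult_right_mono mult_left_mono V_\<Omega>'_le aj) auto
  also have "\<dots> = L * C * M * (\<Omega>' (j - b) * ?v + ?w a j * (\<Omega> (j - b) * ?v))"
    using pos by (simp add: factor[OF jb] field_simps)
  also have "\<dots> \<le> L * C * M * (M * (M * C * L) ^ length js * kernel_prod ?w j js b
      + ?w a j * (M * (M * C * L) ^ length js * omit_one_sum ?w j js b))"
  proof (intro mult_left_mono add_mono Cons.IH jb rest)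
    have "(M * C) ^ length js \<le> (M * C * L) ^ length js"
      using M_pos C_pos L_ge_1 by (intro power_mono) auto
    then have "M * (M * C) ^ length js * kernel_prod ?w j js b
        \<le> M * (M * C * L) ^ length js * kernel_prod ?w j js b"
      using M_pos q_nonneg by (intro mult_right_mono mult_left_mono) auto
    with \<Omega>'_path_prod_le[OF jb rest]
    show "\<Omega>' (j - b) * ?v \<le> M * (M * C * L) ^ length js * kernel_prod ?w j js b" by linarith
  qed (use pos L_ge_1 C_pos M_pos in auto)
  finally show ?case by (simp add: algebra_simps)
qed

section \<open>Estimates of the functionals\<close>

text \<open>
  The cost of one more vertex on a path, up to the factor \<open>1/n\<close>: \<open>M C L\<close> comes from
  \<open>path_prod_le\<close>, \<open>2K + 1\<close> from \<open>resolvent_kernel_le\<close>, one factor \<open>2\<close> from \<open>norm_resolvent_le\<close>;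
  the other factor \<open>2\<close> absorbs the number of steps that can be omitted.
\<close>

definition D :: real where "D = 4 * M * C * L * (2 * K + 1)"

lemma D_pos: "0 < D"
  unfolding D_def using M_pos C_pos L_ge_1 K_nonneg by simp

lemma norm_S_sum_le:
  assumes n: "n \<ge> 1" and z: "norm z \<le> real n / 2"
    and a: "even (a - int n)" and b: "even (b - int n)"
  shows "norm (S_sum V a b k n z) \<le> M * (D / real n) ^ k / \<Omega> (a - b)"
  unfolding S_sum_def
proof (rule norm_infsum_lists_le)
  fix J assume J: "finite J" "J \<subseteq> admissible_indices n"
  let ?w = "\<lambda>i j. 1 / \<omega> (i - j)"
  let ?h = "\<lambda>j. 1 / \<bar>real_of_int ((int n)\<^sup>2 - j\<^sup>2)\<bar>"
  interpret summable_kernel ?w ?h "{j. even (j - int n)}" J "(2 * K + 1) / real n"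
    by (rule kernel_summable_kernel[OF n J])
  have ab: "even (a - b)" using a b by presburger
  note \<Omega>_ab = \<Omega>_pos[OF ab]
  have "norm (path_prod V a js b / (\<Prod>j\<leftarrow>js. (of_int ((int n)\<^sup>2 - j\<^sup>2) + z)))
      \<le> M * (2 * M * C * L) ^ k / \<Omega> (a - b) * ((\<Prod>j\<leftarrow>js. ?h j) * omit_one_sum ?w a js b)"
    if "set js \<subseteq> J \<and> length js = k" for js
  proof -
    have js: "set js \<subseteq> J" "length js = k" using that by auto
    have "\<forall>j\<in>set js. even (j - b)"
      using js(1) J(2) b by (fastforce simp: admissible_indices_def)
    from path_prod_le[OF ab this]
    have p: "norm (path_prod V a js b) \<le> M * (M * C * L) ^ k * omit_one_sum ?w a js b / \<Omega> (a - b)"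
      using \<Omega>_ab by (simp add: js(2) field_simps)
    have "norm (path_prod V a js b / (\<Prod>j\<leftarrow>js. (of_int ((int n)\<^sup>2 - j\<^sup>2) + z)))
        = norm (path_prod V a js b) * (1 / norm (\<Prod>j\<leftarrow>js. (of_int ((int n)\<^sup>2 - j\<^sup>2) + z :: complex)))"
      by (simp add: norm_divide)
    also have "\<dots> \<le> (M * (M * C * L) ^ k * omit_one_sum ?w a js b / \<Omega> (a - b))
        * (2 ^ k * (\<Prod>j\<leftarrow>js. ?h j))"
      using norm_resolvent_prod_le[OF n z, of js] js J(2) p
      by (intro mult_mono) (simp_all del: of_int_diff of_int_power add: order_trans[OF norm_ge_zero p])
    finally show ?thesis by (simp add: power_mult_distrib mult_ac)
  qed
  then have "(\<Sum>js | set js \<subseteq> J \<and> length js = k.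
        norm (path_prod V a js b / (\<Prod>j\<leftarrow>js. (of_int ((int n)\<^sup>2 - j\<^sup>2) + z))))
      \<le> M * (2 * M * C * L) ^ k / \<Omega> (a - b)
        * (\<Sum>js | set js \<subseteq> J \<and> length js = k. (\<Prod>j\<leftarrow>js. ?h j) * omit_one_sum ?w a js b)"
    unfolding sum_distrib_left by (intro sum_mono) auto
  also have "\<dots> \<le> M * (2 * M * C * L) ^ k / \<Omega> (a - b) * ((real k + 1) * ((2 * K + 1) / real n) ^ k)"
    using M_pos C_pos L_ge_1 \<Omega>_ab by (intro mult_left_mono sum_omit_one_le) (use a b in auto)
  also have "\<dots> \<le> M * (2 * M * C * L) ^ k / \<Omega> (a - b) * (2 ^ k * ((2 * K + 1) / real n) ^ k)"
  proof (intro mult_left_mono mult_right_mono)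
    show "real k + 1 \<le> 2 ^ k" using Suc_leI[OF less_exp[of k]]
      by (metis of_nat_Suc of_nat_le_iff of_nat_numeral of_nat_power add.commute)
  qed (use M_pos C_pos L_ge_1 K_nonneg \<Omega>_ab in auto)
  also have "\<dots> = M * (D / real n) ^ k / \<Omega> (a - b)"
  proof -
    have "D / real n = (2 * M * C * L) * (2 * ((2 * K + 1) / real n))" by (simp add: D_def)
    then have "(D / real n) ^ k = (2 * M * C * L) ^ k * (2 ^ k * ((2 * K + 1) / real n) ^ k)"
      by (metis power_mult_distrib)
    then show ?thesis by (simp only: times_divide_eq_left times_divide_eq_right mult.assoc)
  qed
  finally show "(\<Sum>js | set js \<subseteq> J \<and> length js = k.
        norm (path_prod V a js b / (\<Prod>j\<leftarrow>js. (of_int ((int n)\<^sup>2 - j\<^sup>2) + z))))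
      \<le> M * (D / real n) ^ k / \<Omega> (a - b)" .
qed

text \<open>
  A path of two steps that covers the distance \<open>2n\<close> has a step of length at least \<open>n\<close>, whose
  coefficient is controlled by \<open>\<rho>\<close> instead of \<open>M\<close>.
\<close>

lemma norm_S_sum_1_le:
  assumes n: "n \<ge> 1" and z: "norm z \<le> real n / 2"
    and a: "even (a - int n)" and b: "even (b - int n)" and dist: "\<bar>a - b\<bar> = 2 * int n"
    and \<rho>: "\<And>k. even k \<Longrightarrow> int n \<le> \<bar>k\<bar> \<Longrightarrow> norm (V k) * \<Omega> k \<le> \<rho>" "0 \<le> \<rho>"
  shows "norm (S_sum V a b (Suc 0) n z) \<le> D / real n * \<rho> / \<Omega> (a - b)"
  unfolding S_sum_def
proof (rule norm_infsum_lists_le)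
  fix J assume J: "finite J" "J \<subseteq> admissible_indices n"
  let ?w = "\<lambda>i j. 1 / \<omega> (i - j)"
  let ?h = "\<lambda>j. 1 / \<bar>real_of_int ((int n)\<^sup>2 - j\<^sup>2)\<bar>"
  have ab: "even (a - b)" using a b by presburger
  note \<Omega>_ab = \<Omega>_pos[OF ab]
  have bound: "norm (V (a - j) * V (j - b) / (of_int ((int n)\<^sup>2 - j\<^sup>2) + z))
      \<le> 2 * L * C * M * \<rho> / \<Omega> (a - b) * (?h j * ?w a j + ?h j * ?w b j)" if "j \<in> J" for j
  proof -
    have j: "j \<in> admissible_indices n" using that J(2) by auto
    then have aj: "even (a - j)" and jb: "even (j - b)"
      using a b by (auto simp: admissible_indices_def)
    note pos = \<omega>_pos[OF aj] \<omega>_pos[OF jb] \<Omega>'_pos[OF aj] \<Omega>'_pos[OF jb] \<Omega>_pos[OF aj] \<Omega>_pos[OF jb]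
    have sym: "\<omega> (j - b) = \<omega> (b - j)" using \<omega>_sym[OF jb] by simp
    have "int n \<le> \<bar>a - j\<bar> \<or> int n \<le> \<bar>j - b\<bar>" using dist by linarith
    then have r: "(norm (V (a - j)) * \<Omega> (a - j)) * (norm (V (j - b)) * \<Omega> (j - b)) \<le> M * \<rho>"
    proof
      assume "int n \<le> \<bar>a - j\<bar>"
      then have "(norm (V (a - j)) * \<Omega> (a - j)) * (norm (V (j - b)) * \<Omega> (j - b)) \<le> \<rho> * M"
        using pos by (intro mult_mono \<rho> V_bound aj jb) auto
      then show ?thesis by (simp add: mult.commute)
    next
      assume "int n \<le> \<bar>j - b\<bar>"
      then show ?thesis
        using pos M_pos by (intro mult_mono \<rho> V_bound aj jb) auto
    qed
    have "\<Omega> (a - b) \<le> (L * (\<omega> (a - j) + \<omega> (j - b))) * (C * \<Omega>' (a - j) * \<Omega>' (j - b))"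
      unfolding factor[OF ab]
      using \<omega>_add_le[OF aj jb] \<Omega>'_add_le[OF aj jb] pos ab
      by (intro mult_mono) (auto intro!: mult_nonneg_nonneg less_imp_le[OF \<Omega>'_pos] add_nonneg_nonneg less_imp_le[OF order_less_le_trans[OF zero_less_one L_ge_1]])
    also have "\<dots> = L * C * (?w a j + ?w b j) * (\<Omega> (a - j) * \<Omega> (j - b))"
      using pos by (simp add: factor[OF aj] factor[OF jb] sym field_simps)
    finally have "\<Omega> (a - b) * norm (V (a - j) * V (j - b))
        \<le> L * C * (?w a j + ?w b j) * (\<Omega> (a - j) * \<Omega> (j - b)) * norm (V (a - j) * V (j - b))"
      by (rule mult_right_mono) simp
    also have "\<dots> = L * C * (?w a j + ?w b j)
        * ((norm (V (a - j)) * \<Omega> (a - j)) * (norm (V (j - b)) * \<Omega> (j - b)))"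
      by (simp add: norm_mult)
    also have "\<dots> \<le> L * C * (?w a j + ?w b j) * (M * \<rho>)"
      using pos L_ge_1 C_pos by (intro mult_left_mono r) (auto simp: sym)
    finally have p: "norm (V (a - j) * V (j - b)) \<le> L * C * (?w a j + ?w b j) * (M * \<rho>) / \<Omega> (a - b)"
      using \<Omega>_ab by (simp add: field_simps)
    have "norm (V (a - j) * V (j - b) / (of_int ((int n)\<^sup>2 - j\<^sup>2) + z))
        = norm (V (a - j) * V (j - b)) * (1 / norm (of_int ((int n)\<^sup>2 - j\<^sup>2) + z :: complex))"
      by (simp add: norm_divide)
    also have "\<dots> \<le> (L * C * (?w a j + ?w b j) * (M * \<rho>) / \<Omega> (a - b)) * (2 * ?h j)"
      using norm_resolvent_le[OF n j z] p
      by (intro mult_mono) (simp_all del: of_int_diff of_int_power add: order_trans[OF norm_ge_zero p])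
    finally show ?thesis by (simp add: algebra_simps add_divide_distrib)
  qed
  have empty: "{js. set js \<subseteq> J \<and> js = []} = {[]}" by auto
  have "(\<Sum>js | set js \<subseteq> J \<and> length js = Suc 0.
        norm (path_prod V a js b / (\<Prod>j\<leftarrow>js. (of_int ((int n)\<^sup>2 - j\<^sup>2) + z))))
      = (\<Sum>j\<in>J. norm (V (a - j) * V (j - b) / (of_int ((int n)\<^sup>2 - j\<^sup>2) + z)))"
    unfolding sum_lists_Suc by (simp add: empty)
  also have "\<dots> \<le> 2 * L * C * M * \<rho> / \<Omega> (a - b) * ((\<Sum>j\<in>J. ?h j * ?w a j) + (\<Sum>j\<in>J. ?h j * ?w b j))"
    unfolding sum.distrib[symmetric] sum_distrib_left by (rule sum_mono) (rule bound)
  also have "\<dots> \<le> 2 * L * C * M * \<rho> / \<Omega> (a - b)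
      * ((2 * K + 1) / real n + (2 * K + 1) / real n)"
    using L_ge_1 C_pos M_pos \<rho>(2) \<Omega>_ab
    by (intro mult_left_mono add_mono resolvent_kernel_le n J a b) auto
  also have "\<dots> = D / real n * \<rho> / \<Omega> (a - b)"
    using n \<Omega>_ab by (simp add: D_def field_simps)
  finally show "(\<Sum>js | set js \<subseteq> J \<and> length js = Suc 0.
        norm (path_prod V a js b / (\<Prod>j\<leftarrow>js. (of_int ((int n)\<^sup>2 - j\<^sup>2) + z))))
      \<le> D / real n * \<rho> / \<Omega> (a - b)" .
qed

text \<open>
  For \<open>n \<ge> 2 D\<close> the terms from the second one on are dominated by a geometric series of ratio at
  most \<open>1/2\<close>, whose sum is at most twice its first term.
\<close>

lemma norm_suminf_S_sum_le:
  assumes n: "n \<ge> 1" "2 * D \<le> real n" and z: "norm z \<le> real n / 2"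
    and a: "even (a - int n)" and b: "even (b - int n)" and dist: "\<bar>a - b\<bar> = 2 * int n"
    and \<rho>: "\<And>k. even k \<Longrightarrow> int n \<le> \<bar>k\<bar> \<Longrightarrow> norm (V k) * \<Omega> k \<le> \<rho>" "0 \<le> \<rho>"
  shows "norm (\<Sum>k. S_sum V a b (Suc k) n z) * (real n * \<Omega> (a - b)) \<le> D * \<rho> + 2 * M * D\<^sup>2 / real n"
proof -
  define q where "q = D / real n"
  have q: "0 \<le> q" "q \<le> 1 / 2" using n D_pos by (auto simp: q_def field_simps)
  have \<Omega>: "0 < \<Omega> (a - b)" using a b by (intro \<Omega>_pos) presburger
  let ?S = "\<lambda>k. S_sum V a b (Suc k) n z"
  have tail: "norm (?S (Suc k)) \<le> M * q\<^sup>2 / \<Omega> (a - b) * q ^ k" for k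
    using norm_S_sum_le[OF n(1) z a b, of "Suc (Suc k)"]
    by (simp add: q_def[symmetric] power2_eq_square mult_ac)
  have geom: "summable (\<lambda>k. M * q\<^sup>2 / \<Omega> (a - b) * q ^ k)"
    using q by (intro summable_mult summable_geometric) auto
  have "summable (\<lambda>k. ?S (Suc k))" by (rule summable_comparison_test'[OF geom tail])
  then have "summable ?S" by (subst (asm) summable_Suc_iff)
  then have "suminf ?S = ?S 0 + (\<Sum>k. ?S (Suc k))" using suminf_split_head[of ?S] by simp
  then have "norm (suminf ?S) \<le> norm (?S 0) + norm (\<Sum>k. ?S (Suc k))"
    by (simp add: norm_triangle_ineq)
  also have "norm (\<Sum>k. ?S (Suc k)) \<le> (\<Sum>k. M * q\<^sup>2 / \<Omega> (a - b) * q ^ k)"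
    by (rule norm_suminf_le[OF tail geom])
  also have "\<dots> = M * q\<^sup>2 / \<Omega> (a - b) * (1 / (1 - q))"
    using q by (subst suminf_mult) (auto simp: suminf_geometric intro!: summable_geometric)
  also have "\<dots> \<le> M * q\<^sup>2 / \<Omega> (a - b) * 2"
    using q M_pos \<Omega> by (intro mult_left_mono) (auto simp: field_simps)
  also have "norm (?S 0) \<le> q * \<rho> / \<Omega> (a - b)"
    unfolding q_def by (rule norm_S_sum_1_le[OF n(1) z a b dist \<rho>])
  finally have "norm (suminf ?S) \<le> (q * \<rho> + 2 * M * q\<^sup>2) / \<Omega> (a - b)"
    by (simp add: add_divide_distrib mult_ac)
  then have "norm (suminf ?S) * (real n * \<Omega> (a - b))
      \<le> (q * \<rho> + 2 * M * q\<^sup>2) / \<Omega> (a - b) * (real n * \<Omega> (a - b))"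
    using \<Omega> by (intro mult_right_mono) auto
  also have "\<dots> = D * \<rho> + 2 * M * D\<^sup>2 / real n"
    using \<Omega> n(1) by (simp add: q_def power2_eq_square field_simps)
  finally show ?thesis .
qed

end

section \<open>Constants of the weights\<close>

lemma weight_abs:
  assumes "weight \<Omega>" "even k"
  shows "\<Omega> \<bar>k\<bar> = \<Omega> k"
  using assms by (auto simp: weight_def abs_if)

lemma weight_mono_abs:
  assumes "weight \<Omega>" "even k" "even m" "\<bar>k\<bar> \<le> \<bar>m\<bar>"
  shows "\<Omega> k \<le> \<Omega> m"
proof -
  have "\<Omega> \<bar>k\<bar> \<le> \<Omega> \<bar>m\<bar>" using assms by (simp add: weight_def)
  then show ?thesis using assms by (simp add: weight_abs)
qed

lemma weight_ge_1:
  assumes "weight \<Omega>" "even k"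
  shows "1 \<le> \<Omega> k"
  using weight_mono_abs[of \<Omega> 0 k] assms by (simp add: weight_def)

text \<open>By monotonicity \<open>\<omega>(k + m) \<le> \<omega>(2 max(\<bar>k\<bar>, \<bar>m\<bar>))\<close>, to which the doubling bound applies.\<close>

lemma slowly_increasing_add_le:
  assumes w: "weight \<omega>" and "slowly_increasing \<omega>"
  obtains L where "1 \<le> L"
    "\<And>k m. even k \<Longrightarrow> even m \<Longrightarrow> \<omega> (k + m) \<le> L * (\<omega> k + \<omega> m)"
proof -
  obtain B where B: "\<And>k. even k \<Longrightarrow> k > 0 \<Longrightarrow> \<omega> (2 * k) / \<omega> k \<le> B"
    using assms(2) by (auto simp: slowly_increasing_def bdd_above_def)
  define L where "L = max B 1"
  have double: "\<omega> (2 * k) \<le> L * \<omega> k" if "even k" for k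
  proof (cases "k = 0")
    case True
    then show ?thesis using w by (simp add: weight_def L_def)
  next
    case False
    have pos: "0 < \<omega> \<bar>k\<bar>" using w that by (simp add: weight_def)
    have "\<omega> (2 * \<bar>k\<bar>) / \<omega> \<bar>k\<bar> \<le> L" using B[of "\<bar>k\<bar>"] False that by (simp add: L_def)
    then have "\<omega> (2 * \<bar>k\<bar>) \<le> L * \<omega> \<bar>k\<bar>" using pos by (simp add: field_simps)
    then show ?thesis using weight_abs[OF w that] weight_abs[OF w, of "2 * k"] by (simp add: abs_mult)
  qed
  have "\<omega> (k + m) \<le> L * (\<omega> k + \<omega> m)" if km: "even k" "even m" for k m
  proof -
    have L: "L \<ge> 0" by (simp add: L_def)
    have pos: "0 \<le> \<omega> k" "0 \<le> \<omega> m" using weight_ge_1[OF w] km by fastforce+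
    have "\<omega> (k + m) \<le> L * max (\<omega> k) (\<omega> m)"
    proof (cases "\<bar>k\<bar> \<le> \<bar>m\<bar>")
      case True
      then have "\<omega> (k + m) \<le> \<omega> (2 * m)" by (intro weight_mono_abs[OF w]) (use km in auto)
      also note double[OF km(2)]
      also have "L * \<omega> m \<le> L * max (\<omega> k) (\<omega> m)" using L by (intro mult_left_mono) auto
      finally show ?thesis .
    next
      case False
      then have "\<omega> (k + m) \<le> \<omega> (2 * k)" by (intro weight_mono_abs[OF w]) (use km in auto)
      also note double[OF km(1)]
      also have "L * \<omega> k \<le> L * max (\<omega> k) (\<omega> m)" using L by (intro mult_left_mono) auto
      finally show ?thesis .
    qed
    also have "\<dots> \<le> L * (\<omega> k + \<omega> m)" using L pos by (intro mult_left_mono) auto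
    finally show ?thesis .
  qed
  then show thesis using that[of L] by (simp add: L_def)
qed

lemma factored_weight_exists:
  assumes factor: "\<And>k. even k \<Longrightarrow> \<Omega> k = \<omega> k * \<Omega>' k"
    and "weight \<Omega>'" "almost_submultiplicative \<Omega>'" "weight \<omega>" "slowly_increasing \<omega>"
    and summable: "(\<lambda>k. 1 / (real_of_int \<bar>k\<bar> * \<omega> k)) summable_on {k. even k \<and> k \<noteq> 0}"
  obtains C L K where "factored_weight \<Omega> \<omega> \<Omega>' C L K"
proof -
  obtain C where C: "0 < C" "\<And>k m. even k \<Longrightarrow> even m \<Longrightarrow> \<Omega>' (k + m) \<le> C * \<Omega>' k * \<Omega>' m"
    using assms(3) by (auto simp: almost_submultiplicative_def)
  obtain L where L: "1 \<le> L" "\<And>k m. even k \<Longrightarrow> even m \<Longrightarrow> \<omega> (k + m) \<le> L * (\<omega> k + \<omega> m)"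
    using slowly_increasing_add_le[OF assms(4,5)] by blast
  define K where "K = (\<Sum>\<^sub>\<infinity>k\<in>{k. even k \<and> k \<noteq> 0}. 1 / (real_of_int \<bar>k\<bar> * \<omega> k))"
  have K: "(\<Sum>k\<in>F. 1 / (real_of_int \<bar>k\<bar> * \<omega> k)) \<le> K" if "finite F" "F \<subseteq> {k. even k \<and> k \<noteq> 0}" for F
    unfolding K_def
    by (rule finite_sum_le_infsum[OF summable that])
       (use assms(4) in \<open>auto simp: weight_def intro!: divide_nonneg_nonneg mult_nonneg_nonneg less_imp_le\<close>)
  have "factored_weight \<Omega> \<omega> \<Omega>' C L K"
  proof
    show "\<Omega> k = \<omega> k * \<Omega>' k" if "even k" for k using factor[OF that] .
    show "\<omega> (- k) = \<omega> k" "1 \<le> \<omega> k" "0 < \<Omega>' k" if "even k" for k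
      using assms(2,4) that weight_ge_1[of \<omega> k] by (simp_all add: weight_def)
    show "\<omega> k \<le> \<omega> m" if "even k" "even m" "\<bar>k\<bar> \<le> \<bar>m\<bar>" for k m
      using weight_mono_abs[OF assms(4) that] .
    show "(\<Sum>k\<in>F. 1 / (\<bar>real_of_int k\<bar> * \<omega> k)) \<le> K"
      if "finite F" "F \<subseteq> {k. even k \<and> k \<noteq> 0}" for F
      using K[OF that] by simp
  qed (fact C L)+
  then show thesis by (rule that)
qed

section \<open>Asymptotic equivalence\<close>

lemma unif_asymp_equivI:
  assumes "\<And>\<epsilon>. 0 < \<epsilon> \<Longrightarrow> eventually (\<lambda>n. \<forall>z. norm z \<le> real n / 2 \<longrightarrow>
             norm (b n z - a n) \<le> \<epsilon> * norm (a n) \<and> a n \<noteq> 0) (at_top_in \<Delta>)"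
  shows "unif_asymp_equiv \<Delta> b a"
  unfolding unif_asymp_equiv_def
proof (rule order_tendstoI)
  fix y :: ennreal assume "0 < y"
  then obtain x where x: "0 < x" "x < y" using dense by blast
  define \<epsilon> where "\<epsilon> = enn2real x"
  have "x < top" using x(2) by (rule less_le_trans) simp
  then have \<epsilon>: "0 < \<epsilon>" "ennreal \<epsilon> < y"
    using x by (simp_all add: \<epsilon>_def enn2real_positive_iff)
  show "eventually (\<lambda>n. (SUP z\<in>cball 0 (real n / 2). ennreal (norm (b n z / a n - 1))) < y)
          (at_top_in \<Delta>)"
    using assms[OF \<epsilon>(1)]
  proof eventually_elim
    case (elim n)
    have "norm (b n z / a n - 1) \<le> \<epsilon>" if "norm z \<le> real n / 2" for z
    proof -
      have "a n \<noteq> 0" and le: "norm (b n z - a n) \<le> \<epsilon> * norm (a n)" using elim that by auto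
      then have "b n z / a n - 1 = (b n z - a n) / a n" by (simp add: diff_divide_distrib)
      then show ?thesis using le \<open>a n \<noteq> 0\<close> by (simp add: norm_divide divide_le_eq)
    qed
    then have "(SUP z\<in>cball 0 (real n / 2). ennreal (norm (b n z / a n - 1))) \<le> ennreal \<epsilon>"
      by (intro SUP_least ennreal_leI) auto
    then show ?case using \<epsilon>(2) by (rule le_less_trans)
  qed
qed simp

text \<open>
  It remains to compare the error \<open>D \<rho> + O(1/n)\<close> with \<open>\<bar>a\<^sub>n\<bar> n \<Omega>(2n)\<close>, where \<open>a\<^sub>n = V(\<pm>2n)\<close> in the application: either
  \<open>\<rho> = M\<close> is fixed and the latter is unbounded, or \<open>\<rho>\<close> is arbitrarily small and the latter is
  bounded below.  Both cases are covered by the hypothesis that the quotient becomes small.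
\<close>

lemma (in bounded_coeffs) unif_asymp_equiv_suminf_S_sum:
  assumes beta: "\<And>n z. b n z = a n + (\<Sum>k. S_sum V (s * int n) (- s * int n) (Suc k) n z)"
    and s: "s = 1 \<or> s = -1"
    and small: "\<And>\<epsilon>. 0 < \<epsilon> \<Longrightarrow> \<exists>\<rho>\<ge>0.
        eventually (\<lambda>n. \<forall>k. even k \<longrightarrow> int n \<le> \<bar>k\<bar> \<longrightarrow> norm (V k) * \<Omega> k \<le> \<rho>) (at_top_in \<Delta>) \<and>
        eventually (\<lambda>n. D * \<rho> + 2 * M * D\<^sup>2 / real n
                          \<le> \<epsilon> * (norm (a n) * real n * \<Omega> (2 * int n))) (at_top_in \<Delta>)"
    and nonzero: "eventually (\<lambda>n. a n \<noteq> 0) (at_top_in \<Delta>)"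
    and \<Omega>_sym: "\<And>k. even k \<Longrightarrow> \<Omega> (- k) = \<Omega> k"
  shows "unif_asymp_equiv \<Delta> b a"
proof (rule unif_asymp_equivI)
  fix \<epsilon> :: real assume "0 < \<epsilon>"
  from small[OF this] obtain \<rho> where \<rho>: "0 \<le> \<rho>"
    "eventually (\<lambda>n. \<forall>k. even k \<longrightarrow> int n \<le> \<bar>k\<bar> \<longrightarrow> norm (V k) * \<Omega> k \<le> \<rho>) (at_top_in \<Delta>)"
    "eventually (\<lambda>n. D * \<rho> + 2 * M * D\<^sup>2 / real n
                          \<le> \<epsilon> * (norm (a n) * real n * \<Omega> (2 * int n))) (at_top_in \<Delta>)"
    by blast
  obtain N :: nat where N: "2 * D \<le> real N" using real_arch_simple by blast
  have "eventually (\<lambda>n. n \<ge> max N 1) (at_top_in \<Delta>)"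
    by (rule filter_leD[OF inf_le1 eventually_ge_at_top])
  then show "eventually (\<lambda>n. \<forall>z. norm z \<le> real n / 2 \<longrightarrow>
        norm (b n z - a n) \<le> \<epsilon> * norm (a n) \<and> a n \<noteq> 0) (at_top_in \<Delta>)"
    using \<rho>(2,3) nonzero
  proof eventually_elim
    case (elim n)
    have n: "n \<ge> 1" "2 * D \<le> real n" using elim N by auto
    have \<Omega>: "\<Omega> (s * int n - - s * int n) = \<Omega> (2 * int n)"
      using s \<Omega>_sym[of "2 * int n"] by auto
    have pos: "0 < real n * \<Omega> (2 * int n)" using n \<Omega>_pos[of "2 * int n"] by simp
    have "norm (b n z - a n) \<le> \<epsilon> * norm (a n)" if z: "norm z \<le> real n / 2" for z
    proof -
      have "norm (\<Sum>k. S_sum V (s * int n) (- s * int n) (Suc k) n z)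
          * (real n * \<Omega> (s * int n - - s * int n)) \<le> D * \<rho> + 2 * M * D\<^sup>2 / real n"
        by (rule norm_suminf_S_sum_le[OF n z]) (use s elim \<rho>(1) in auto)
      then have "norm (b n z - a n) * (real n * \<Omega> (2 * int n)) \<le> D * \<rho> + 2 * M * D\<^sup>2 / real n"
        by (simp only: beta \<Omega> add_diff_cancel_left')
      also have "\<dots> \<le> (\<epsilon> * norm (a n)) * (real n * \<Omega> (2 * int n))"
        using elim by (simp add: mult_ac)
      finally show ?thesis using pos by (simp only: mult_le_cancel_right_pos)
    qed
    then show ?case using elim by auto
  qed
qed

theorem theorem11:
  fixes \<Omega> \<omega> \<Omega>' :: "int \<Rightarrow> real"
    and v :: "(real \<Rightarrow> complex) \<Rightarrow> complex"
    and V :: "int \<Rightarrow> complex"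
  assumes "weight \<Omega>"
    and "\<And>k. even k \<Longrightarrow> \<Omega> k = \<omega> k * \<Omega>' k"
    and "weight \<Omega>'" and "almost_submultiplicative \<Omega>'"
    and "weight \<omega>" and "slowly_increasing \<omega>"
    and "(\<lambda>k. 1 / (real_of_int \<bar>k\<bar> * \<omega> k)) summable_on {k. even k \<and> k \<noteq> 0}"
    and "v \<in> W_infty \<Omega>"
    and "V = fourier_coeff v"
  shows
    "(\<forall>\<Delta> :: nat set. infinite \<Delta> \<longrightarrow>
        filterlim (\<lambda>n. norm (V (2 * int n)) * real n * \<Omega> (2 * int n)) at_top (at_top_in \<Delta>) \<longrightarrow>
        filterlim (\<lambda>n. norm (V (- 2 * int n)) * real n * \<Omega> (2 * int n)) at_top (at_top_in \<Delta>) \<longrightarrow>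
        unif_asymp_equiv \<Delta> (beta_plus v) (\<lambda>n. V (2 * int n)) \<and>
        unif_asymp_equiv \<Delta> (beta_minus v) (\<lambda>n. V (- 2 * int n)))
   \<and>
     (((\<lambda>k. norm (V k) * \<Omega> k) \<longlongrightarrow> 0) (inf (filtercomap abs at_top) (principal {k. even k})) \<longrightarrow>
      (\<forall>\<Delta> :: nat set. infinite \<Delta> \<longrightarrow>
        (\<exists>c>0. \<forall>n\<in>\<Delta>. norm (V (2 * int n)) * real n * \<Omega> (2 * int n) \<ge> c \<and>
                     norm (V (- 2 * int n)) * real n * \<Omega> (2 * int n) \<ge> c) \<longrightarrow>
        unif_asymp_equiv \<Delta> (beta_plus v) (\<lambda>n. V (2 * int n)) \<and>
        unif_asymp_equiv \<Delta> (beta_minus v) (\<lambda>n. V (- 2 * int n))))"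
proof -
  obtain C L K where fw: "factored_weight \<Omega> \<omega> \<Omega>' C L K"
    using factored_weight_exists[OF assms(2-7)] by blast
  obtain B where B: "\<And>k. even k \<Longrightarrow> norm (V k) * \<Omega> k \<le> B"
    using assms(8,9) by (auto simp: W_infty_def bdd_above_def)
  interpret bounded_coeffs \<Omega> \<omega> \<Omega>' C L K V "max B 1"
    using fw by (auto simp: bounded_coeffs_def bounded_coeffs_axioms_def intro!: max.coboundedI1 B)
  let ?M = "max B 1"
  have \<Omega>_sym: "\<And>k. even k \<Longrightarrow> \<Omega> (- k) = \<Omega> k" using assms(1) by (simp add: weight_def)
  have beta: "beta_plus v n z = V (2 * int n) + (\<Sum>k. S_sum V (1 * int n) (- 1 * int n) (Suc k) n z)"
    "beta_minus v n z = V (- 2 * int n) + (\<Sum>k. S_sum V (- 1 * int n) (- (- 1) * int n) (Suc k) n z)"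
    for n z
    by (simp_all add: beta_plus_def beta_minus_def S21_def S12_def assms(9))

  \<comment> \<open>Taking \<open>\<rho> = M\<close>, the whole error is at most the constant \<open>D M + 2 M D\<^sup>2\<close>.\<close>
  have unbounded: "unif_asymp_equiv \<Delta> b a"
    if beta: "\<And>n z. b n z = a n + (\<Sum>k. S_sum V (s * int n) (- s * int n) (Suc k) n z)"
      and s: "s = 1 \<or> s = -1"
      and lim: "filterlim (\<lambda>n. norm (a n) * real n * \<Omega> (2 * int n)) at_top (at_top_in \<Delta>)"
    for \<Delta> b a s
  proof (rule unif_asymp_equiv_suminf_S_sum[OF beta s _ _ \<Omega>_sym])
    have "eventually (\<lambda>n. 1 \<le> norm (a n) * real n * \<Omega> (2 * int n)) (at_top_in \<Delta>)"
      using lim by (simp add: filterlim_at_top)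
    then show "eventually (\<lambda>n. a n \<noteq> 0) (at_top_in \<Delta>)"
      by eventually_elim auto
    fix \<epsilon> :: real assume \<epsilon>: "0 < \<epsilon>"
    have large: "eventually (\<lambda>n. (D * ?M + 2 * ?M * D\<^sup>2) / \<epsilon> \<le> norm (a n) * real n * \<Omega> (2 * int n))
        (at_top_in \<Delta>)"
      using lim by (simp add: filterlim_at_top)
    have "eventually (\<lambda>n. D * ?M + 2 * ?M * D\<^sup>2 / real n
        \<le> \<epsilon> * (norm (a n) * real n * \<Omega> (2 * int n))) (at_top_in \<Delta>)"
      using large filter_leD[OF inf_le1 eventually_ge_at_top[of 1]]
    proof eventually_elim
      case (elim n)
      have "2 * ?M * D\<^sup>2 / real n \<le> 2 * ?M * D\<^sup>2"
        using divide_left_mono[of 1 "real n" "2 * ?M * D\<^sup>2"] elim(2) M_pos by simp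
      moreover have "D * ?M + 2 * ?M * D\<^sup>2 \<le> \<epsilon> * (norm (a n) * real n * \<Omega> (2 * int n))"
        using elim(1) \<epsilon> by (simp add: pos_divide_le_eq mult.commute)
      ultimately show ?case by linarith
    qed
    then show "\<exists>\<rho>\<ge>0.
        eventually (\<lambda>n. \<forall>k. even k \<longrightarrow> int n \<le> \<bar>k\<bar> \<longrightarrow> norm (V k) * \<Omega> k \<le> \<rho>) (at_top_in \<Delta>) \<and>
        eventually (\<lambda>n. D * \<rho> + 2 * ?M * D\<^sup>2 / real n
                          \<le> \<epsilon> * (norm (a n) * real n * \<Omega> (2 * int n))) (at_top_in \<Delta>)"
      using V_bound by (intro exI[of _ ?M]) auto
  qed

  \<comment> \<open>With \<open>\<rho> = \<epsilon> c / (2 D)\<close> both summands of the error are eventually at most \<open>\<epsilon> c / 2\<close>.\<close>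
  have vanishing: "unif_asymp_equiv \<Delta> b a"
    if beta: "\<And>n z. b n z = a n + (\<Sum>k. S_sum V (s * int n) (- s * int n) (Suc k) n z)"
      and s: "s = 1 \<or> s = -1"
      and lim: "((\<lambda>k. norm (V k) * \<Omega> k) \<longlongrightarrow> 0) (inf (filtercomap abs at_top) (principal {k. even k}))"
      and c: "0 < c" "\<And>n. n \<in> \<Delta> \<Longrightarrow> c \<le> norm (a n) * real n * \<Omega> (2 * int n)"
    for \<Delta> b a s c
  proof (rule unif_asymp_equiv_suminf_S_sum[OF beta s _ _ \<Omega>_sym])
    have in_\<Delta>: "eventually (\<lambda>n. n \<in> \<Delta>) (at_top_in \<Delta>)"
      by (rule filter_leD[OF inf_le2]) (simp add: eventually_principal)
    then show "eventually (\<lambda>n. a n \<noteq> 0) (at_top_in \<Delta>)"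
    proof eventually_elim
      case (elim n)
      then show ?case using c(1) c(2)[of n] by auto
    qed
    fix \<epsilon> :: real assume \<epsilon>: "0 < \<epsilon>"
    define \<rho> where "\<rho> = \<epsilon> * c / (2 * D)"
    have \<rho>: "0 < \<rho>" using \<epsilon> c D_pos by (simp add: \<rho>_def)
    have "eventually (\<lambda>k. norm (V k) * \<Omega> k < \<rho>)
        (inf (filtercomap abs at_top) (principal {k. even k}))"
      using order_tendstoD(2)[OF lim \<rho>] .
    then obtain X where X: "\<And>k. X \<le> \<bar>k\<bar> \<Longrightarrow> even k \<Longrightarrow> norm (V k) * \<Omega> k < \<rho>"
      by (auto simp: eventually_inf_principal eventually_filtercomap eventually_at_top_linorder)
    have "eventually (\<lambda>n. nat X \<le> n) (at_top_in \<Delta>)"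
      by (rule filter_leD[OF inf_le1 eventually_ge_at_top])
    then have tail: "eventually (\<lambda>n. \<forall>k. even k \<longrightarrow> int n \<le> \<bar>k\<bar> \<longrightarrow> norm (V k) * \<Omega> k \<le> \<rho>) (at_top_in \<Delta>)"
    proof eventually_elim
      case (elim n)
      show ?case
      proof (intro allI impI)
        fix k assume k: "even k" "int n \<le> \<bar>k\<bar>"
        then have "X \<le> \<bar>k\<bar>" using elim by linarith
        then show "norm (V k) * \<Omega> k \<le> \<rho>" using X k(1) by (simp add: less_imp_le)
      qed
    qed
    have "((\<lambda>n. 2 * ?M * D\<^sup>2 / real n) \<longlongrightarrow> 0) sequentially"
      by (rule lim_const_over_n)
    then have "eventually (\<lambda>n. 2 * ?M * D\<^sup>2 / real n < \<epsilon> * c / 2) sequentially"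
      by (rule order_tendstoD) (use \<epsilon> c in simp)
    then have "eventually (\<lambda>n. 2 * ?M * D\<^sup>2 / real n < \<epsilon> * c / 2) (at_top_in \<Delta>)"
      by (rule filter_leD[OF inf_le1])
    then have "eventually (\<lambda>n. D * \<rho> + 2 * ?M * D\<^sup>2 / real n
        \<le> \<epsilon> * (norm (a n) * real n * \<Omega> (2 * int n))) (at_top_in \<Delta>)"
      using in_\<Delta>
    proof eventually_elim
      case (elim n)
      have "D * \<rho> = \<epsilon> * c / 2" using D_pos by (simp add: \<rho>_def)
      moreover have "\<epsilon> * c \<le> \<epsilon> * (norm (a n) * real n * \<Omega> (2 * int n))"
        using c(2)[OF elim(2)] \<epsilon> by (intro mult_left_mono) auto
      ultimately show ?case using elim(1) by linarith
    qed
    with tail \<rho> show "\<exists>\<rho>\<ge>0.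
        eventually (\<lambda>n. \<forall>k. even k \<longrightarrow> int n \<le> \<bar>k\<bar> \<longrightarrow> norm (V k) * \<Omega> k \<le> \<rho>) (at_top_in \<Delta>) \<and>
        eventually (\<lambda>n. D * \<rho> + 2 * ?M * D\<^sup>2 / real n
                          \<le> \<epsilon> * (norm (a n) * real n * \<Omega> (2 * int n))) (at_top_in \<Delta>)"
      by (intro exI[of _ \<rho>]) auto
  qed

  show ?thesis
  proof (intro conjI allI impI)
    fix \<Delta> :: "nat set"
    assume p: "filterlim (\<lambda>n. norm (V (2 * int n)) * real n * \<Omega> (2 * int n)) at_top (at_top_in \<Delta>)"
      and m: "filterlim (\<lambda>n. norm (V (- 2 * int n)) * real n * \<Omega> (2 * int n)) at_top (at_top_in \<Delta>)"
    show "unif_asymp_equiv \<Delta> (beta_plus v) (\<lambda>n. V (2 * int n))"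
      by (rule unbounded[OF beta(1) _ p]) simp
    show "unif_asymp_equiv \<Delta> (beta_minus v) (\<lambda>n. V (- 2 * int n))"
      by (rule unbounded[OF beta(2) _ m]) simp
  next
    fix \<Delta> :: "nat set"
    assume lim: "((\<lambda>k. norm (V k) * \<Omega> k) \<longlongrightarrow> 0) (inf (filtercomap abs at_top) (principal {k. even k}))"
      and "\<exists>c>0. \<forall>n\<in>\<Delta>. norm (V (2 * int n)) * real n * \<Omega> (2 * int n) \<ge> c \<and>
                     norm (V (- 2 * int n)) * real n * \<Omega> (2 * int n) \<ge> c"
    then obtain c where c: "0 < c"
      "\<And>n. n \<in> \<Delta> \<Longrightarrow> c \<le> norm (V (2 * int n)) * real n * \<Omega> (2 * int n)"
      "\<And>n. n \<in> \<Delta> \<Longrightarrow> c \<le> norm (V (- 2 * int n)) * real n * \<Omega> (2 * int n)"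
      by blast
    show "unif_asymp_equiv \<Delta> (beta_plus v) (\<lambda>n. V (2 * int n))"
      by (rule vanishing[OF beta(1) _ lim c(1,2)]) simp_all
    show "unif_asymp_equiv \<Delta> (beta_minus v) (\<lambda>n. V (- 2 * int n))"
      by (rule vanishing[OF beta(2) _ lim c(1,3)]) simp_all
  qed
qed

end
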